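(* Let $G$ be a nontrivial countable group and let $\lambda\in LO(G)$ be an isolated left order. Then the dynamical realization $\rho_\lambda:G\to\mathrm{Homeo}_+(\mathbb{R})$ of $\lambda$ is cocompact, i.e. there is a compact interval $I\subset\mathbb{R}$ such that every orbit $\rho_\lambda(G)x$ ($x\in\mathbb{R}$) intersects $I$.
   Context: A left order $\lambda$ on $G$ is a total order $<_\lambda$ with $f<_\lambda g\Rightarrow hf<_\lambda hg$ for all $f,g,h\in G$. It is identified with the map $\lambda:G\setminus\{e\}\to\{\pm1\}$, $\lambda(g)=1$ iff $g>_\lambda e$. The set $LO(G)$ of left orders is thus a closed subset of $\{\pm1\}^{G\setminus\{e\}}$ with the topology of pointwise convergence; $\lambda$ is isolated if it is an isolated point of $LO(G)$. Dynamical realization: fix $x_0\in\mathbb{R}$ (the base point) and an enumeration $G=\{g_i\mid i\in\mathbb{N}\}$ with $g_1=e$. Define $\iota:G\to\mathbb{R}$ inductively: $\iota(g_1)=x_0$; if $\iota$ is defined on $\{g_1,\dots,g_n\}$, ordered as $g_{i_1}<_\lambda\cdots<_\lambda g_{i_n}$, put $\iota(g_{n+1})=\iota(g_{i_1})-1$ if $g_{n+1}<_\lambda g_{i_1}$, $\iota(g_{n+1})=\iota(g_{i_n})+1$ if $g_{i_n}<_\lambda g_{n+1}$, and $\iota(g_{n+1})=\frac12(\iota(g_{i_k})+\iota(g_{i_{k+1}}))$ if $g_{i_k}<_\lambda g_{n+1}<_\lambda g_{i_{k+1}}$. The action $h\cdot\iota(g)=\iota(hg)$ of $G$ on $\iota(G)$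 extends to a continuous action on the closure of $\iota(G)$, and then to $\mathbb{R}$ by making it affine on each gap of the closure. The resulting homomorphism $\rho_\lambda:G\to\mathrm{Homeo}_+(\mathbb{R})$ is the dynamical realization of $\lambda$ based at $x_0$ (for the chosen, arbitrary, enumeration). *)

theory Defs
  imports "HOL-Analysis.Analysis" "HOL-Algebra.Group_Action"
begin

text \<open>
  An order is the set \<open>L\<close> of pairs \<open>(f, g)\<close> with \<open>f\<close> strictly below \<open>g\<close>.
  As \<^const>\<open>strict_linear_order_on\<close> says nothing about where the pairs live, confinement to the
  carrier is required separately.
\<close>

definition left_order :: "('a, 'm) monoid_scheme \<Rightarrow> 'a rel \<Rightarrow> bool" where
  "left_order G L \<longleftrightarrow>
     L \<subseteq> carrier G \<times> carrier G \<and> strict_linear_order_on (carrier G) L \<and>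
     (\<forall>f\<in>carrier G. \<forall>g\<in>carrier G. \<forall>h\<in>carrier G.
        (f, g) \<in> L \<longrightarrow> (h \<otimes>\<^bsub>G\<^esub> f, h \<otimes>\<^bsub>G\<^esub> g) \<in> L)"

definition order_sign :: "('a, 'm) monoid_scheme \<Rightarrow> 'a rel \<Rightarrow> 'a \<Rightarrow> int" where
  "order_sign G L = (\<lambda>g\<in>carrier G - {\<one>\<^bsub>G\<^esub>}. if (\<one>\<^bsub>G\<^esub>, g) \<in> L then 1 else -1)"

definition LO :: "('a, 'm) monoid_scheme \<Rightarrow> ('a \<Rightarrow> int) set" where
  "LO G = order_sign G ` {L. left_order G L}"

definition LO_topology :: "('a, 'm) monoid_scheme \<Rightarrow> ('a \<Rightarrow> int) topology" where
  "LO_topology G =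
     subtopology
       (product_topology (\<lambda>_. discrete_topology {-1, 1}) (carrier G - {\<one>\<^bsub>G\<^esub>})) (LO G)"

definition isolated_left_order :: "('a, 'm) monoid_scheme \<Rightarrow> 'a rel \<Rightarrow> bool" where
  "isolated_left_order G L \<longleftrightarrow>
     left_order G L \<and> openin (LO_topology G) {order_sign G L}"

definition homeo_plus :: "(real \<Rightarrow> real) monoid" where
  "homeo_plus =
     \<lparr>carrier = {f. strict_mono f \<and> (\<exists>g. homeomorphism UNIV UNIV f g)},
      mult = (\<circ>), one = id\<rparr>"

text \<open>
  The enumeration \<open>e\<close> starts at index \<open>0\<close>, so \<open>e (Suc n)\<close> is placed relative to the elements
  \<open>e j\<close> with \<open>j \<le> n\<close>.  The clauses are exhaustive and determine \<open>\<iota>\<close> on the range of \<open>e\<close>.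
\<close>

definition realization_embedding ::
  "'a rel \<Rightarrow> (nat \<Rightarrow> 'a) \<Rightarrow> real \<Rightarrow> ('a \<Rightarrow> real) \<Rightarrow> bool" where
  "realization_embedding L e x0 \<iota> \<longleftrightarrow>
     \<iota> (e 0) = x0 \<and>
     (\<forall>n. \<forall>k\<le>n.
        ((\<forall>j\<le>n. j \<noteq> k \<longrightarrow> (e k, e j) \<in> L) \<and> (e (Suc n), e k) \<in> L \<longrightarrow>
           \<iota> (e (Suc n)) = \<iota> (e k) - 1) \<and>
        ((\<forall>j\<le>n. j \<noteq> k \<longrightarrow> (e j, e k) \<in> L) \<and> (e k, e (Suc n)) \<in> L \<longrightarrow>
           \<iota> (e (Suc n)) = \<iota> (e k) + 1) \<and>
        (\<forall>l\<le>n. (e k, e (Suc n)) \<in> L \<and> (e (Suc n), e l) \<in> L \<and>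
             \<not> (\<exists>j\<le>n. (e k, e j) \<in> L \<and> (e j, e l) \<in> L) \<longrightarrow>
           \<iota> (e (Suc n)) = (\<iota> (e k) + \<iota> (e l)) / 2))"

text \<open>
  The extension to the line is given by the properties that determine it: continuity, which is
  part of membership in \<^const>\<open>homeo_plus\<close>, fixes \<open>\<rho> h\<close> on the closure of the embedded group, and
  on the components of the complement, the gaps, it is affine.  In a nontrivial group a left order
  has no least and no greatest element, so the embedded group is unbounded on both sides and every
  gap is bounded.
\<close>

definition dynamical_realization ::
  "('a, 'm) monoid_scheme \<Rightarrow> 'a rel \<Rightarrow> (nat \<Rightarrow> 'a) \<Rightarrow> real \<Rightarrow> ('a \<Rightarrow> real \<Rightarrow> real) \<Rightarrow> bool" where
  "dynamical_realization G L e x0 \<rho> \<longleftrightarrow>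
     \<rho> \<in> hom G homeo_plus \<and>
     (\<exists>\<iota>. realization_embedding L e x0 \<iota> \<and>
        (\<forall>h\<in>carrier G. \<forall>g\<in>carrier G. \<rho> h (\<iota> g) = \<iota> (h \<otimes>\<^bsub>G\<^esub> g)) \<and>
        (\<forall>h\<in>carrier G. \<forall>J\<in>components (- closure (\<iota> ` carrier G)).
           \<exists>a b. \<forall>x\<in>J. \<rho> h x = a * x + b))"

definition cocompact_action :: "('a, 'm) monoid_scheme \<Rightarrow> ('a \<Rightarrow> real \<Rightarrow> real) \<Rightarrow> bool" where
  "cocompact_action G \<rho> \<longleftrightarrow> (\<exists>a b. \<forall>x. Group_Action.orbit G \<rho> x \<inter> {a..b} \<noteq> {})"

end

theory Submission
  imports Defs
begin

text \<open>
  An isolated left order is pinned down by its signs on finitely many elements \<open>F\<close>.  On the other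
  hand, reversing a left order outside a proper convex subgroup \<open>H\<close> gives a different left order
  with the same signs on \<open>H\<close>.  Hence no proper convex subgroup contains \<open>F\<close>
  (\<open>convex_subgroup_eq_carrier_if_isolated\<close>).

  Let \<open>I\<close> be a compact interval containing the base point \<open>x0\<close> and its translates by \<open>F\<close>, and
  suppose that the orbit of \<open>x\<close> misses \<open>I\<close>.  The gap of that orbit around \<open>I\<close> is permuted with the
  other gaps of the orbit, so its stabilizer \<open>H\<close> is a subgroup; it consists of the \<open>g\<close> that move
  \<open>x0\<close> within the gap.  It contains \<open>F\<close> because \<open>I\<close> lies in the gap, and it is convex because
  \<open>g \<mapsto> g x0\<close> preserves the order (\<open>realization_embedding_strict_mono\<close>).  It is proper because the
  orbit of \<open>x0\<close> is unbounded in both directions (\<open>realization_embedding_unbounded_above\<close> and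
  \<open>realization_embedding_unbounded_below\<close>) and so jumps over \<open>x\<close>.  This contradicts the first
  paragraph, and therefore every orbit meets \<open>I\<close>.
\<close>

section \<open>Left orders and positive cones\<close>

locale left_ordered_group = group G for G (structure) +
  fixes L
  assumes left_order: "left_order G L"
begin

lemma
  shows in_carrier: "(f, g) \<in> L \<Longrightarrow> f \<in> carrier G \<and> g \<in> carrier G"
    and less_trans: "(f, g) \<in> L \<Longrightarrow> (g, h) \<in> L \<Longrightarrow> (f, h) \<in> L"
    and less_irrefl: "(f, f) \<notin> L"
    and less_linear: "f \<in> carrier G \<Longrightarrow> g \<in> carrier G \<Longrightarrow> f \<noteq> g \<Longrightarrow> (f, g) \<in> L \<or> (g, f) \<in> L"
  using left_order unfolding left_order_def strict_linear_order_on_def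
  by (auto simp: irrefl_def total_on_def dest: transD)

lemma less_asym: "(f, g) \<in> L \<Longrightarrow> (g, f) \<notin> L"
  using less_trans less_irrefl by blast

lemma mult_left_mono: "h \<in> carrier G \<Longrightarrow> (f, g) \<in> L \<Longrightarrow> (h \<otimes> f, h \<otimes> g) \<in> L"
  using left_order in_carrier unfolding left_order_def by blast

lemma mult_left_less_iff:
  assumes "f \<in> carrier G" "g \<in> carrier G" "h \<in> carrier G"
  shows "(h \<otimes> f, h \<otimes> g) \<in> L \<longleftrightarrow> (f, g) \<in> L"
  using mult_left_mono[of "inv h" "h \<otimes> f" "h \<otimes> g"] mult_left_mono[of h f g] assms
  by (auto simp: m_assoc[symmetric])

lemma ex_greater:
  assumes "carrier G \<noteq> {\<one>}" "h \<in> carrier G"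
  shows "\<exists>g. (h, g) \<in> L"
proof -
  obtain g where g: "g \<in> carrier G" "g \<noteq> \<one>" using assms(1) one_closed by blast
  have "(\<one>, g) \<in> L \<or> (\<one>, inv g) \<in> L"
    using less_linear[of \<one> g] mult_left_mono[of "inv g" g \<one>] g by auto
  then obtain k where "(\<one>, k) \<in> L" by blast
  then show ?thesis using mult_left_mono[of h \<one> k] assms by auto
qed

end

definition cone_order :: "('a, 'm) monoid_scheme \<Rightarrow> 'a set \<Rightarrow> 'a rel" where
  "cone_order G P = {(f, g). f \<in> carrier G \<and> g \<in> carrier G \<and> inv\<^bsub>G\<^esub> f \<otimes>\<^bsub>G\<^esub> g \<in> P}"

lemma (in group) left_order_cone_order:
  assumes mult: "\<And>a b. a \<in> P \<Longrightarrow> b \<in> P \<Longrightarrow> a \<otimes> b \<in> P"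
    and one: "\<one> \<notin> P"
    and total: "\<And>g. g \<in> carrier G \<Longrightarrow> g \<noteq> \<one> \<Longrightarrow> g \<in> P \<or> inv g \<in> P"
  shows "left_order G (cone_order G P)"
  unfolding left_order_def strict_linear_order_on_def
proof (intro conjI ballI impI)
  show "cone_order G P \<subseteq> carrier G \<times> carrier G" by (auto simp: cone_order_def)
  show "trans (cone_order G P)"
  proof (rule transI)
    fix f g h assume "(f, g) \<in> cone_order G P" "(g, h) \<in> cone_order G P"
    then have c: "f \<in> carrier G" "g \<in> carrier G" "h \<in> carrier G"
      and p: "inv f \<otimes> g \<in> P" "inv g \<otimes> h \<in> P" by (auto simp: cone_order_def)
    have "g \<otimes> (inv g \<otimes> h) = h" using c by (simp add: m_assoc[symmetric])
    then have "(inv f \<otimes> g) \<otimes> (inv g \<otimes> h) = inv f \<otimes> h" using c by (simp add: m_assoc)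
    with mult[OF p] c show "(f, h) \<in> cone_order G P" by (simp add: cone_order_def)
  qed
  show "irrefl (cone_order G P)" using one by (auto simp: irrefl_def cone_order_def)
  show "total_on (carrier G) (cone_order G P)"
  proof (rule total_onI)
    fix f g assume c: "f \<in> carrier G" "g \<in> carrier G" and "f \<noteq> g"
    then have "inv f \<otimes> g \<noteq> \<one>" using inv_solve_left' by fastforce
    with total[of "inv f \<otimes> g"] c have "inv f \<otimes> g \<in> P \<or> inv g \<otimes> f \<in> P"
      by (auto simp: inv_mult_group)
    with c show "(f, g) \<in> cone_order G P \<or> (g, f) \<in> cone_order G P" by (auto simp: cone_order_def)
  qed
  fix f g h assume c: "f \<in> carrier G" "g \<in> carrier G" "h \<in> carrier G"
    and "(f, g) \<in> cone_order G P"
  moreover have "inv h \<otimes> (h \<otimes> g) = g" using c by (simp add: m_assoc[symmetric])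
  then have "inv (h \<otimes> f) \<otimes> (h \<otimes> g) = inv f \<otimes> g" using c by (simp add: inv_mult_group m_assoc)
  ultimately show "(h \<otimes> f, h \<otimes> g) \<in> cone_order G P" by (simp add: cone_order_def)
qed

section \<open>Reversing an order outside a convex subgroup\<close>

definition flipped_cone :: "('a, 'm) monoid_scheme \<Rightarrow> 'a rel \<Rightarrow> 'a set \<Rightarrow> 'a set" where
  "flipped_cone G L H =
     {g \<in> H. (\<one>\<^bsub>G\<^esub>, g) \<in> L} \<union> {g \<in> carrier G - H. (g, \<one>\<^bsub>G\<^esub>) \<in> L}"

text \<open>
  Convexity makes \<open>H\<close> small compared with everything outside it: multiplying an element outside
  \<open>H\<close> by an element of \<open>H\<close>, on either side, does not change its sign.  So the negative elements
  outside \<open>H\<close> and the positive elements of \<open>H\<close> are jointly closed under products.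
\<close>
lemma (in left_ordered_group) left_order_flipped:
  assumes H: "subgroup H G"
    and convex: "\<And>f g h. f \<in> H \<Longrightarrow> h \<in> H \<Longrightarrow> (f, g) \<in> L \<Longrightarrow> (g, h) \<in> L \<Longrightarrow> g \<in> H"
  shows "left_order G (cone_order G (flipped_cone G L H))"
proof (rule left_order_cone_order)
  interpret H: subgroup H G by (rule H)
  note [simp] = H.mem_carrier
  show "\<one> \<notin> flipped_cone G L H" using less_irrefl by (auto simp: flipped_cone_def)
  show "g \<in> flipped_cone G L H \<or> inv g \<in> flipped_cone G L H"
    if g: "g \<in> carrier G" "g \<noteq> \<one>" for g
  proof -
    have "inv g \<in> H \<longleftrightarrow> g \<in> H" using g H.m_inv_closed[of "inv g"] by auto
    moreover have "(\<one>, g) \<in> L \<longleftrightarrow> (inv g, \<one>) \<in> L" "(g, \<one>) \<in> L \<longleftrightarrow> (\<one>, inv g) \<in> L"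
      using mult_left_less_iff[of \<one> g "inv g"] mult_left_less_iff[of g \<one> "inv g"] g by auto
    ultimately show ?thesis using less_linear[of \<one> g] g by (auto simp: flipped_cone_def)
  qed
  fix a b assume a: "a \<in> flipped_cone G L H" and b: "b \<in> flipped_cone G L H"
  have c: "a \<in> carrier G" "b \<in> carrier G" using a b by (auto simp: flipped_cone_def)
  have cancel_left: "b \<in> H" if "a \<in> H" "a \<otimes> b \<in> H"
    using H.m_closed[OF H.m_inv_closed[OF that(1)] that(2)] c by (simp add: m_assoc[symmetric])
  have cancel_right: "a \<in> H" if "b \<in> H" "a \<otimes> b \<in> H"
    using H.m_closed[OF that(2) H.m_inv_closed[OF that(1)]] c by (simp add: m_assoc)
  have neg: "(a \<otimes> b, \<one>) \<in> L" if "a \<otimes> b \<notin> H" "(\<one>, a \<otimes> b) \<notin> L"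
    using that less_linear[of \<one> "a \<otimes> b"] c H.one_closed by (metis m_closed one_closed)
  consider "a \<in> H" "b \<in> H" | "a \<in> H" "b \<notin> H" | "a \<notin> H" "b \<in> H" | "a \<notin> H" "b \<notin> H" by blast
  then show "a \<otimes> b \<in> flipped_cone G L H"
  proof cases
    case 1
    then have "(\<one>, a) \<in> L" "(\<one>, b) \<in> L" using a b by (auto simp: flipped_cone_def)
    with mult_left_mono[of a \<one> b] c less_trans have "(\<one>, a \<otimes> b) \<in> L" by auto
    with 1 show ?thesis by (auto simp: flipped_cone_def)
  next
    case 2
    then have "(b, \<one>) \<in> L" using b by (auto simp: flipped_cone_def)
    then have "(a \<otimes> b, a) \<in> L" using mult_left_mono[of a b \<one>] c by auto
    \<comment> \<open>A positive \<open>a \<otimes> b\<close> would lie between \<open>\<one>\<close> and \<open>a\<close>.\<close>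
    then have "(\<one>, a \<otimes> b) \<notin> L"
      using convex[of \<one> a "a \<otimes> b"] 2 cancel_left H.one_closed by blast
    with neg 2 cancel_left c show ?thesis by (auto simp: flipped_cone_def)
  next
    case 3
    \<comment> \<open>A positive \<open>a \<otimes> b\<close> would put \<open>inv a\<close> between \<open>\<one>\<close> and \<open>b\<close>.\<close>
    have "(a, \<one>) \<in> L" using 3 a by (auto simp: flipped_cone_def)
    then have 4: "(\<one>, inv a) \<in> L" using mult_left_mono[of "inv a" a \<one>] c by auto
    have "(\<one>, a \<otimes> b) \<notin> L"
    proof
      assume "(\<one>, a \<otimes> b) \<in> L"
      then have "(inv a, b) \<in> L"
        using mult_left_mono[of "inv a" \<one> "a \<otimes> b"] c by (auto simp: m_assoc[symmetric])
      with 4 convex[of \<one> b "inv a"] 3 have "inv a \<in> H" by auto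
      then show False using 3 c H.m_inv_closed[of "inv a"] by auto
    qed
    with neg 3 cancel_right c show ?thesis by (auto simp: flipped_cone_def)
  next
    case 4
    then have "(a, \<one>) \<in> L" "(b, \<one>) \<in> L" using a b by (auto simp: flipped_cone_def)
    moreover from this have "(a \<otimes> b, a) \<in> L" using mult_left_mono[of a b \<one>] c by auto
    ultimately show ?thesis
      using convex[of "a \<otimes> b" \<one> a] 4 c less_trans by (auto simp: flipped_cone_def)
  qed
qed

section \<open>Isolated orders\<close>

text \<open>
  Basic open sets of the product topology constrain finitely many coordinates, and a neighbourhood
  of an isolated point can be taken to contain no other order.
\<close>
lemma isolated_left_order_finitely_determined:
  assumes "isolated_left_order G L"
  obtains F where "finite F" "F \<subseteq> carrier G - {\<one>\<^bsub>G\<^esub>}"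
    "\<And>L'. left_order G L' \<Longrightarrow> (\<And>g. g \<in> F \<Longrightarrow> order_sign G L' g = order_sign G L g) \<Longrightarrow>
       order_sign G L' = order_sign G L"
proof -
  let ?C = "carrier G - {\<one>\<^bsub>G\<^esub>}"
  let ?X = "\<lambda>_::'a. discrete_topology {-1, 1::int}"
  obtain T where T: "openin (product_topology ?X ?C) T" "{order_sign G L} = T \<inter> LO G"
    using assms by (auto simp: isolated_left_order_def LO_topology_def openin_subtopology)
  then have "order_sign G L \<in> T" by blast
  with T(1) obtain U where U: "finite {i \<in> ?C. U i \<noteq> topspace (?X i)}"
      "order_sign G L \<in> PiE ?C U" "PiE ?C U \<subseteq> T"
    unfolding openin_product_topology_alt by meson
  show ?thesis
  proof (rule that[OF U(1)])
    fix L' assume L': "left_order G L'"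
      and eq: "\<And>g. g \<in> {i \<in> ?C. U i \<noteq> topspace (?X i)} \<Longrightarrow> order_sign G L' g = order_sign G L g"
    have "order_sign G L' i \<in> U i" if i: "i \<in> ?C" for i
    proof (cases "U i = topspace (?X i)")
      case True
      then show ?thesis using i by (auto simp: order_sign_def)
    next
      case False
      then show ?thesis using eq[of i] i U(2) by auto
    qed
    then have "order_sign G L' \<in> PiE ?C U" by (auto simp: order_sign_def PiE_def extensional_def)
    then have "order_sign G L' \<in> T \<inter> LO G" using U(3) L' by (auto simp: LO_def)
    with T(2) show "order_sign G L' = order_sign G L" by blast
  qed auto
qed

text \<open>
  If \<open>H\<close> were proper, reversing the order outside \<open>H\<close> would keep the signs on \<open>F\<close> and change
  those outside \<open>H\<close>.
\<close>
lemma (in left_ordered_group) convex_subgroup_eq_carrier_if_isolated: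
  assumes F: "\<And>L'. left_order G L' \<Longrightarrow> (\<And>g. g \<in> F \<Longrightarrow> order_sign G L' g = order_sign G L g) \<Longrightarrow>
      order_sign G L' = order_sign G L"
    and H: "subgroup H G" "F \<subseteq> H"
    and convex: "\<And>f g h. f \<in> H \<Longrightarrow> h \<in> H \<Longrightarrow> (f, g) \<in> L \<Longrightarrow> (g, h) \<in> L \<Longrightarrow> g \<in> H"
  shows "H = carrier G"
proof (rule ccontr)
  let ?L' = "cone_order G (flipped_cone G L H)"
  assume "H \<noteq> carrier G"
  then obtain g where g: "g \<in> carrier G" "g \<notin> H" using subgroup.subset[OF H(1)] by blast
  have one: "\<one> \<in> H" by (rule subgroup.one_closed[OF H(1)])
  have pos: "(\<one>, k) \<in> ?L' \<longleftrightarrow> (if k \<in> H then (\<one>, k) \<in> L else (k, \<one>) \<in> L)"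
    if "k \<in> carrier G" for k
    using that by (auto simp: cone_order_def flipped_cone_def)
  have "order_sign G ?L' k = order_sign G L k" if "k \<in> F" for k
    using pos[of k] that H(2) subgroup.mem_carrier[OF H(1)]
    by (auto simp: order_sign_def restrict_def)
  then have "order_sign G ?L' g = order_sign G L g"
    using F[OF left_order_flipped[OF H(1) convex]] by simp
  then have "(g, \<one>) \<in> L \<longleftrightarrow> (\<one>, g) \<in> L"
    using g one pos[of g] by (auto simp: order_sign_def split: if_splits)
  then show False using less_linear[of g \<one>] less_asym g one by auto
qed

section \<open>The embedding of the group into the line\<close>

lemma finite_maximizer:
  fixes f :: "'b \<Rightarrow> 'c::linorder"
  assumes "finite A" "A \<noteq> {}"
  shows "\<exists>k\<in>A. \<forall>j\<in>A. f j \<le> f k"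
proof -
  have "Max (f ` A) \<in> f ` A" using assms by simp
  then obtain k where "k \<in> A" "Max (f ` A) = f k" by blast
  with assms(1) show ?thesis by (metis Max_ge finite_imageI imageI)
qed

text \<open>
  A new point is placed strictly between its neighbours among the points placed before it.  By
  induction those neighbours are the points extremal for \<open>\<iota>\<close> on either side.
\<close>
lemma (in left_ordered_group) realization_embedding_strict_mono:
  assumes e: "bij_betw e UNIV (carrier G)" and \<iota>: "realization_embedding L e x0 \<iota>"
    and "(f, g) \<in> L"
  shows "\<iota> f < \<iota> g"
proof -
  have ec: "e i \<in> carrier G" for i using e by (auto simp: bij_betw_def)
  have lin: "(e i, e j) \<in> L \<or> (e j, e i) \<in> L" if "i \<noteq> j" for i j
    using less_linear[OF ec ec] that e by (auto simp: bij_betw_def inj_def)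
  have main: "\<forall>i\<le>n. \<forall>j\<le>n. (e i, e j) \<in> L \<longrightarrow> \<iota> (e i) < \<iota> (e j)" for n
  proof (induction n)
    case 0
    then show ?case using less_irrefl by auto
  next
    case (Suc n)
    let ?m = "Suc n"
    define A where "A = {j. j \<le> n \<and> (e j, e ?m) \<in> L}"
    define B where "B = {j. j \<le> n \<and> (e ?m, e j) \<in> L}"
    have fin: "finite A" "finite B" by (auto simp: A_def B_def)
    have AB: "j \<in> A \<or> j \<in> B" if "j \<le> n" for j using that lin[of j ?m] by (auto simp: A_def B_def)
    have maxA: "\<exists>k\<in>A. \<forall>j\<in>A. \<iota> (e j) \<le> \<iota> (e k) \<and> (j \<noteq> k \<longrightarrow> (e j, e k) \<in> L)" if nonempty: "A \<noteq> {}"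
    proof -
      obtain k where k: "k \<in> A" "\<forall>j\<in>A. \<iota> (e j) \<le> \<iota> (e k)"
        using finite_maximizer[OF fin(1) nonempty, of "\<lambda>j. \<iota> (e j)"] by blast
      have "(e j, e k) \<in> L" if "j \<in> A" "j \<noteq> k" for j
      proof (rule ccontr)
        assume "(e j, e k) \<notin> L"
        then have "(e k, e j) \<in> L" using lin that(2) by blast
        then have "\<iota> (e k) < \<iota> (e j)" using Suc k(1) that(1) by (simp add: A_def)
        then show False using k(2) that(1) by force
      qed
      then show ?thesis using k by blast
    qed
    have minB: "\<exists>k\<in>B. \<forall>j\<in>B. \<iota> (e k) \<le> \<iota> (e j) \<and> (j \<noteq> k \<longrightarrow> (e k, e j) \<in> L)" if nonempty: "B \<noteq> {}"
    proof -
      obtain k where k: "k \<in> B" "\<forall>j\<in>B. \<iota> (e k) \<le> \<iota> (e j)"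
        using finite_maximizer[OF fin(2) nonempty, of "\<lambda>j. - \<iota> (e j)"] by auto
      have "(e k, e j) \<in> L" if "j \<in> B" "j \<noteq> k" for j
      proof (rule ccontr)
        assume "(e k, e j) \<notin> L"
        then have "(e j, e k) \<in> L" using lin that(2) by blast
        then have "\<iota> (e j) < \<iota> (e k)" using Suc k(1) that(1) by (simp add: B_def)
        then show False using k(2) that(1) by force
      qed
      then show ?thesis using k by blast
    qed
    have "(\<forall>j\<in>A. \<iota> (e j) < \<iota> (e ?m)) \<and> (\<forall>j\<in>B. \<iota> (e ?m) < \<iota> (e j))"
    proof (cases "A = {}"; cases "B = {}")
      assume "A = {}" "B = {}"
      then show ?thesis by simp
    next
      assume A: "A = {}" and "B \<noteq> {}"
      then obtain k where k: "k \<in> B" "\<forall>j\<in>B. \<iota> (e k) \<le> \<iota> (e j) \<and> (j \<noteq> k \<longrightarrow> (e k, e j) \<in> L)"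
        using minB by blast
      then have "\<iota> (e ?m) = \<iota> (e k) - 1"
        using \<iota> A AB unfolding realization_embedding_def B_def by blast
      then show ?thesis using k A by force
    next
      assume "A \<noteq> {}" and B: "B = {}"
      then obtain k where k: "k \<in> A" "\<forall>j\<in>A. \<iota> (e j) \<le> \<iota> (e k) \<and> (j \<noteq> k \<longrightarrow> (e j, e k) \<in> L)"
        using maxA by blast
      then have "\<iota> (e ?m) = \<iota> (e k) + 1"
        using \<iota> B AB unfolding realization_embedding_def A_def by blast
      then show ?thesis using k B by force
    next
      assume "A \<noteq> {}" "B \<noteq> {}"
      then obtain k l where
        k: "k \<in> A" "\<forall>j\<in>A. \<iota> (e j) \<le> \<iota> (e k) \<and> (j \<noteq> k \<longrightarrow> (e j, e k) \<in> L)" and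
        l: "l \<in> B" "\<forall>j\<in>B. \<iota> (e l) \<le> \<iota> (e j) \<and> (j \<noteq> l \<longrightarrow> (e l, e j) \<in> L)"
        using maxA minB by meson
      have kl: "k \<le> n" "l \<le> n" "(e k, e ?m) \<in> L" "(e ?m, e l) \<in> L"
        using k(1) l(1) by (auto simp: A_def B_def)
      have "\<not> (\<exists>j\<le>n. (e k, e j) \<in> L \<and> (e j, e l) \<in> L)"
        using AB k(2) l(2) less_asym less_irrefl by metis
      then have "\<iota> (e ?m) = (\<iota> (e k) + \<iota> (e l)) / 2"
        using \<iota> kl unfolding realization_embedding_def by blast
      moreover have "\<iota> (e k) < \<iota> (e l)" using Suc kl less_trans by blast
      ultimately show ?thesis using k l by force
    qed
    then show ?case using Suc less_irrefl by (auto simp: A_def B_def le_Suc_eq)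
  qed
  obtain i j where "f = e i" "g = e j"
    using e in_carrier[OF assms(3)] by (metis bij_betw_imp_surj_on imageE)
  with main[of "max i j"] assms(3) show ?thesis by simp
qed

text \<open>
  There is no greatest element, so record maxima keep occurring along the enumeration, and each of
  them exceeds the previous one by \<open>1\<close>.
\<close>
lemma (in left_ordered_group) realization_embedding_unbounded_above:
  assumes e: "bij_betw e UNIV (carrier G)" and \<iota>: "realization_embedding L e x0 \<iota>"
    and nontrivial: "carrier G \<noteq> {\<one>}"
  shows "\<exists>g\<in>carrier G. y < \<iota> g"
proof -
  have ec: "e i \<in> carrier G" for i using e by (auto simp: bij_betw_def)
  have lin: "(e i, e j) \<in> L \<or> (e j, e i) \<in> L" if "i \<noteq> j" for i j
    using less_linear[OF ec ec] that e by (auto simp: bij_betw_def inj_def)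
  note mono = realization_embedding_strict_mono[OF e \<iota>]
  have step: "\<exists>j. \<iota> (e i) + 1 \<le> \<iota> (e j)" for i
  proof -
    obtain k where k: "k \<le> i" "\<forall>j\<le>i. \<iota> (e j) \<le> \<iota> (e k)"
      using finite_maximizer[of "{..i}" "\<lambda>j. \<iota> (e j)"] by auto
    \<comment> \<open>\<open>e k\<close> stays the greatest element enumerated until \<open>e M\<close>, the first one above it.\<close>
    define M where "M = (LEAST j. (e k, e j) \<in> L)"
    have "\<exists>j. (e k, e j) \<in> L"
      using ex_greater[OF nontrivial ec[of k]] e in_carrier by (metis bij_betw_imp_surj_on imageE)
    then have M: "(e k, e M) \<in> L" unfolding M_def by (rule LeastI_ex)
    have least: "(e k, e j) \<notin> L" if "j < M" for j using not_less_Least that unfolding M_def by blast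
    have "i < M" using mono[OF M] k(2) by (metis not_le)
    then obtain n where n: "M = Suc n" "i \<le> n" by (metis Suc_le_D Suc_le_eq Suc_le_mono)
    have "(e j, e k) \<in> L" if "j \<le> n" "j \<noteq> k" for j using least[of j] lin[OF that(2)] that n by simp
    then have "\<iota> (e M) = \<iota> (e k) + 1"
      using \<iota> M k(1) n unfolding realization_embedding_def by (metis le_trans)
    then show ?thesis using k(2) by (intro exI[of _ M]) auto
  qed
  have "\<exists>j. \<iota> (e 0) + real n \<le> \<iota> (e j)" for n
  proof (induction n)
    case (Suc n)
    then obtain j where "\<iota> (e 0) + real n \<le> \<iota> (e j)" by blast
    moreover obtain j' where "\<iota> (e j) + 1 \<le> \<iota> (e j')" using step by blast
    ultimately show ?case by (intro exI[of _ j']) simp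
  qed auto
  moreover obtain n where "y - \<iota> (e 0) < real n" using reals_Archimedean2 by blast
  ultimately obtain j where "y < \<iota> (e j)" by (smt (verit))
  then show ?thesis using ec by blast
qed

lemma left_order_converse: "left_order G L \<Longrightarrow> left_order G (L\<inverse>)"
  unfolding left_order_def strict_linear_order_on_def by (auto simp: total_on_def irrefl_def)

text \<open>The embedding rule is symmetric under reversing the order and reflecting the line in \<open>0\<close>.\<close>
lemma realization_embedding_converse:
  assumes "realization_embedding L e x0 \<iota>"
  shows "realization_embedding (L\<inverse>) e (- x0) (\<lambda>g. - \<iota> g)"
proof -
  have *: "- \<iota> (e (Suc n)) = (- \<iota> (e k) + - \<iota> (e l)) / 2"
    if "k \<le> n" "l \<le> n" "(e (Suc n), e k) \<in> L" "(e l, e (Suc n)) \<in> L"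
      "\<not> (\<exists>j\<le>n. (e j, e k) \<in> L \<and> (e l, e j) \<in> L)" for n k l
  proof -
    have "\<iota> (e (Suc n)) = (\<iota> (e l) + \<iota> (e k)) / 2"
      using assms that unfolding realization_embedding_def by blast
    then show ?thesis by simp
  qed
  show ?thesis
    unfolding realization_embedding_def converse_iff
  proof (intro conjI allI impI)
    show "- \<iota> (e 0) = - x0" using assms by (simp add: realization_embedding_def)
  qed (use assms * in \<open>auto simp: realization_embedding_def\<close>)
qed

lemma (in left_ordered_group) realization_embedding_unbounded_below:
  assumes e: "bij_betw e UNIV (carrier G)" and \<iota>: "realization_embedding L e x0 \<iota>"
    and nontrivial: "carrier G \<noteq> {\<one>}"
  shows "\<exists>g\<in>carrier G. \<iota> g < y"
proof -
  interpret conv: left_ordered_group G "L\<inverse>"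
    by unfold_locales (rule left_order_converse[OF left_order])
  show ?thesis
    using conv.realization_embedding_unbounded_above[OF e realization_embedding_converse[OF \<iota>]
        nontrivial, of "- y"] by auto
qed

section \<open>Gaps of orbits\<close>

lemma
  assumes "group G" and \<rho>: "\<rho> \<in> hom G homeo_plus"
  shows hom_homeo_plus_mult:
      "g \<in> carrier G \<Longrightarrow> h \<in> carrier G \<Longrightarrow> \<rho> (g \<otimes>\<^bsub>G\<^esub> h) x = \<rho> g (\<rho> h x)"
    and hom_homeo_plus_less_iff: "g \<in> carrier G \<Longrightarrow> \<rho> g x < \<rho> g y \<longleftrightarrow> x < y"
    and hom_homeo_plus_one: "\<rho> \<one>\<^bsub>G\<^esub> x = x"
proof -
  interpret group G by fact
  show mult: "\<rho> (g \<otimes>\<^bsub>G\<^esub> h) x = \<rho> g (\<rho> h x)" if "g \<in> carrier G" "h \<in> carrier G" for g h x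
    using \<rho> that by (simp add: hom_def homeo_plus_def)
  show less: "\<rho> g x < \<rho> g y \<longleftrightarrow> x < y" if "g \<in> carrier G" for g x y
    using \<rho> that by (auto simp: hom_def homeo_plus_def Pi_def strict_mono_less)
  \<comment> \<open>\<open>\<rho> \<one>\<close> is idempotent and injective.\<close>
  show "\<rho> \<one>\<^bsub>G\<^esub> x = x"
    using mult[of "\<one>\<^bsub>G\<^esub>" "\<one>\<^bsub>G\<^esub>" x] less[of "\<one>\<^bsub>G\<^esub>" "\<rho> \<one>\<^bsub>G\<^esub> x" x] less[of "\<one>\<^bsub>G\<^esub>" x "\<rho> \<one>\<^bsub>G\<^esub> x"] by simp
qed

text \<open>
  If the orbit of \<open>x\<close> avoids \<open>p\<close>, this is the stabilizer of the gap of that orbit around \<open>p\<close>: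
  an element preserves the gap iff it moves \<open>p\<close> without crossing the orbit.  Speaking of the cut
  that \<open>p\<close> makes in the orbit avoids the end points of the gap.
\<close>
definition gap_stabilizer :: "('a, 'm) monoid_scheme \<Rightarrow> ('a \<Rightarrow> real \<Rightarrow> real) \<Rightarrow> real \<Rightarrow> real \<Rightarrow> 'a set"
  where "gap_stabilizer G \<rho> x p =
    {g \<in> carrier G. \<forall>k\<in>carrier G. \<rho> k x < \<rho> g p \<longleftrightarrow> \<rho> k x < p}"

lemma subgroup_gap_stabilizer:
  assumes "group G" and \<rho>: "\<rho> \<in> hom G homeo_plus"
  shows "subgroup (gap_stabilizer G \<rho> x p) G"
proof -
  interpret group G by fact
  note mult = hom_homeo_plus_mult[OF assms] and less_iff = hom_homeo_plus_less_iff[OF assms]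
    and one = hom_homeo_plus_one[OF assms]
  \<comment> \<open>Moving \<open>g\<close> to the other side only permutes the orbit of \<open>x\<close>.\<close>
  have shift: "\<rho> k x < \<rho> g y \<longleftrightarrow> \<rho> (inv\<^bsub>G\<^esub> g \<otimes>\<^bsub>G\<^esub> k) x < y"
    if "g \<in> carrier G" "k \<in> carrier G" for g k y
    using less_iff[of g "\<rho> (inv\<^bsub>G\<^esub> g \<otimes>\<^bsub>G\<^esub> k) x" y] mult[of g "inv\<^bsub>G\<^esub> g \<otimes>\<^bsub>G\<^esub> k" x] that
    by (simp add: m_assoc[symmetric])
  show ?thesis
  proof (rule subgroupI)
    show "gap_stabilizer G \<rho> x p \<subseteq> carrier G" by (auto simp: gap_stabilizer_def)
    show "gap_stabilizer G \<rho> x p \<noteq> {}" using one by (auto simp: gap_stabilizer_def)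
  next
    fix g assume "g \<in> gap_stabilizer G \<rho> x p"
    then have g: "g \<in> carrier G" "\<And>k. k \<in> carrier G \<Longrightarrow> \<rho> k x < \<rho> g p \<longleftrightarrow> \<rho> k x < p"
      by (auto simp: gap_stabilizer_def)
    have "\<rho> k x < \<rho> (inv\<^bsub>G\<^esub> g) p \<longleftrightarrow> \<rho> k x < p" if k: "k \<in> carrier G" for k
      using shift[of "inv\<^bsub>G\<^esub> g" k p] g(2)[of "g \<otimes>\<^bsub>G\<^esub> k"] shift[of g "g \<otimes>\<^bsub>G\<^esub> k" p] g(1) k
      by (simp add: m_assoc[symmetric])
    then show "inv\<^bsub>G\<^esub> g \<in> gap_stabilizer G \<rho> x p" using g(1) by (simp add: gap_stabilizer_def)
  next
    fix g h assume "g \<in> gap_stabilizer G \<rho> x p" "h \<in> gap_stabilizer G \<rho> x p"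
    then have g: "g \<in> carrier G" "\<And>k. k \<in> carrier G \<Longrightarrow> \<rho> k x < \<rho> g p \<longleftrightarrow> \<rho> k x < p"
      and h: "h \<in> carrier G" "\<And>k. k \<in> carrier G \<Longrightarrow> \<rho> k x < \<rho> h p \<longleftrightarrow> \<rho> k x < p"
      by (auto simp: gap_stabilizer_def)
    have "\<rho> k x < \<rho> (g \<otimes>\<^bsub>G\<^esub> h) p \<longleftrightarrow> \<rho> k x < p" if k: "k \<in> carrier G" for k
      using shift[of g k "\<rho> h p"] h(2)[of "inv\<^bsub>G\<^esub> g \<otimes>\<^bsub>G\<^esub> k"] shift[of g k p] g(2)[of k]
        mult[of g h p] g(1) h(1) k by simp
    then show "g \<otimes>\<^bsub>G\<^esub> h \<in> gap_stabilizer G \<rho> x p"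
      using g(1) h(1) by (simp add: gap_stabilizer_def)
  qed
qed

section \<open>Cocompactness\<close>

theorem theorem1:
  fixes G :: "('a, 'm) monoid_scheme" and L :: "'a rel"
    and e :: "nat \<Rightarrow> 'a" and x0 :: real and \<rho> :: "'a \<Rightarrow> real \<Rightarrow> real"
  assumes "group G" and "countable (carrier G)" and "carrier G \<noteq> {\<one>\<^bsub>G\<^esub>}"
    and "isolated_left_order G L"
    and "bij_betw e UNIV (carrier G)" and "e 0 = \<one>\<^bsub>G\<^esub>"
    and "dynamical_realization G L e x0 \<rho>"
  shows "cocompact_action G \<rho>"
proof (rule ccontr)
  assume not_cocompact: "\<not> cocompact_action G \<rho>"
  interpret left_ordered_group G L
    using assms(1,4) by (simp add: left_ordered_group_def left_ordered_group_axioms_def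
        isolated_left_order_def)
  obtain \<iota> where \<rho>: "\<rho> \<in> hom G homeo_plus" and \<iota>: "realization_embedding L e x0 \<iota>"
    and equivariant: "\<And>h g. h \<in> carrier G \<Longrightarrow> g \<in> carrier G \<Longrightarrow> \<rho> h (\<iota> g) = \<iota> (h \<otimes>\<^bsub>G\<^esub> g)"
    using assms(7) by (auto simp: dynamical_realization_def)
  have x0: "\<iota> \<one>\<^bsub>G\<^esub> = x0" using \<iota> assms(6) by (simp add: realization_embedding_def)
  have \<rho>x0: "\<rho> g x0 = \<iota> g" if "g \<in> carrier G" for g
    using equivariant[OF that one_closed] that x0 by simp
  note mono = realization_embedding_strict_mono[OF assms(5) \<iota>]
  obtain F where F: "finite F" "F \<subseteq> carrier G - {\<one>\<^bsub>G\<^esub>}"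
    "\<And>L'. left_order G L' \<Longrightarrow> (\<And>g. g \<in> F \<Longrightarrow> order_sign G L' g = order_sign G L g) \<Longrightarrow>
       order_sign G L' = order_sign G L"
    using isolated_left_order_finitely_determined[OF assms(4)] by metis
  define K where "K = insert x0 (\<iota> ` F)"
  have "finite K" using F(1) by (simp add: K_def)
  then have K: "y \<in> {Min K..Max K}" if "y \<in> K" for y using that by simp
  obtain x where "Group_Action.orbit G \<rho> x \<inter> {Min K..Max K} = {}"
    using not_cocompact unfolding cocompact_action_def by blast
  then have miss: "\<rho> k x \<notin> {Min K..Max K}" if "k \<in> carrier G" for k
    using that unfolding orbit_def by blast
  define H where "H = gap_stabilizer G \<rho> x x0"
  have H_iff: "g \<in> H \<longleftrightarrow> g \<in> carrier G \<and> (\<forall>k\<in>carrier G. \<rho> k x < \<iota> g \<longleftrightarrow> \<rho> k x < x0)" for g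
    using \<rho>x0 by (auto simp: H_def gap_stabilizer_def)
  have "H = carrier G"
  proof (rule convex_subgroup_eq_carrier_if_isolated[OF F(3)])
    show "subgroup H G" unfolding H_def by (rule subgroup_gap_stabilizer[OF assms(1) \<rho>])
    show "F \<subseteq> H"
    proof
      fix g assume g: "g \<in> F"
      have "\<rho> k x < \<iota> g \<longleftrightarrow> \<rho> k x < x0" if "k \<in> carrier G" for k
        using miss[OF that] K[of "\<iota> g"] K[of x0] g by (auto simp: K_def)
      then show "g \<in> H" using g F(2) by (auto simp: H_iff)
    qed
    show "g \<in> H" if "f \<in> H" "h \<in> H" "(f, g) \<in> L" "(g, h) \<in> L" for f g h
      using that mono[OF that(3)] mono[OF that(4)] in_carrier[OF that(3)] unfolding H_iff
      by (meson less_trans order_less_trans)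
  qed
  \<comment> \<open>But some translate of \<open>x0\<close> lies on the other side of \<open>x\<close>.\<close>
  then have same_side: "x < \<iota> g \<longleftrightarrow> x < x0" if "g \<in> carrier G" for g
    using that H_iff[of g] hom_homeo_plus_one[OF assms(1) \<rho>] one_closed by metis
  show False
  proof (cases "x < x0")
    case True
    obtain g where "g \<in> carrier G" "\<iota> g < x"
      using realization_embedding_unbounded_below[OF assms(5) \<iota> assms(3)] by blast
    with same_side True show False by fastforce
  next
    case False
    obtain g where "g \<in> carrier G" "x < \<iota> g"
      using realization_embedding_unbounded_above[OF assms(5) \<iota> assms(3)] by blast
    with same_side False show False by blast
  qed
qed

end
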